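(* Let $s\in\mathbb{R}$ be either a transcendental number or a rational number that is neither an integer nor a half-integer (i.e. $s\in\mathbb{Q}\setminus\frac12\mathbb{Z}$). Let $A\subset\mathbb{R}^2$ be a set such that $\Delta(A)\subset\mathbb{Z}^{+}+s$. Then $A$ has at most $3$ elements.
   Context: For $A\subset\mathbb{R}^2$, the distance set is $\Delta(A)=\{|a-a'| : a,a'\in A,\ a\neq a'\}$, where $|\cdot|$ is the Euclidean norm. $\mathbb{Z}^{+}$ denotes the set of nonnegative integers, and $\mathbb{Z}^{+}+s=\{k+s : k\in\mathbb{Z}^{+}\}$. *)

theory Defs
  imports "HOL-Analysis.Analysis" "HOL-Computational_Algebra.Polynomial"
begin

definition distance_set :: "(real ^ 2) set \<Rightarrow> real set" where
  "distance_set A = {dist a a' | a a'. a \<in> A \<and> a' \<in> A \<and> a \<noteq> a'}"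

end

theory Submission
  imports Defs "HOL-Number_Theory.Cong"
begin

text \<open>
  Suppose that \<open>A\<close> contained four points. The six distances between them satisfy an algebraic
  relation, because a tetrahedron lying in a plane has volume zero: with one vertex as origin, the
  Gram determinant of the three edge vectors to the other vertices vanishes, and its entries are
  integer linear combinations of the squared edge lengths (up to a factor \<open>2\<close>). So a
  form \<open>D\<close> of degree three with integer coefficients vanishes at the squared distances
  (\<open>gram_form_plane\<close>). What makes the argument work is that \<open>D\<close> does \<^emph>\<open>not\<close>
  vanish when all edges are equal: its value at a regular tetrahedron of edge \<open>1\<close> is \<open>4\<close>. When all
  distances lie in \<open>\<nat> + s\<close>, the configuration is a perturbation of that
  tetrahedron, in one of two senses.

  If \<open>s\<close> is transcendental, divide the distances \<open>k + s\<close> by \<open>s\<close>. The numbers \<open>1 + k / s\<close> are values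
  at \<open>1 / s\<close> of the polynomials \<open>1 + k X\<close>, so \<open>1 / s\<close> is a root of an integer polynomial. Its
  constant coefficient is \<open>4\<close>, hence it is not the zero polynomial and \<open>s\<close> is algebraic
  (\<open>shifted_distances_algebraic\<close>).

  If \<open>s = p / q\<close> in lowest terms, multiply by \<open>q\<close>: the distances become integers congruent to \<open>p\<close>
  modulo \<open>q\<close>, and therefore \<open>0 = D\<close> is congruent to \<open>4 p\<^sup>6\<close>. Thus \<open>q\<close> divides \<open>4\<close>. As \<open>s\<close> is not an
  integer, \<open>q\<close> is even, so \<open>p\<close> and all the scaled distances are odd. Odd squares are \<open>1\<close> modulo
  \<open>8\<close>, so \<open>0 = D\<close> is congruent to \<open>4\<close> modulo \<open>8\<close>, which is absurd
  (\<open>shifted_distances_integer\<close>).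
\<close>

section \<open>The Gram determinant of a tetrahedron\<close>

text \<open>
  This is the determinant of the symmetric matrix whose entries are twice the inner products of
  the edge vectors \<open>u - p\<close>, \<open>v - p\<close>, \<open>w - p\<close>, written by the law of cosines in terms of a
  function \<open>f\<close> that returns squared distances. It makes sense over any commutative ring, which is
  needed in order to evaluate it on reals, on integers and on polynomials.
\<close>

definition gram_form :: "('p \<Rightarrow> 'p \<Rightarrow> 'r::comm_ring_1) \<Rightarrow> 'p \<Rightarrow> 'p \<Rightarrow> 'p \<Rightarrow> 'p \<Rightarrow> 'r" where
  "gram_form f p u v w =
    (let uv = f p u + f p v - f u v; uw = f p u + f p w - f u w; vw = f p v + f p w - f v w
     in 8 * f p u * f p v * f p w + 2 * uv * uw * vw
        - 2 * f p u * vw\<^sup>2 - 2 * f p v * uw\<^sup>2 - 2 * f p w * uv\<^sup>2)"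

text \<open>Three vectors of the plane are linearly dependent, so their Gram determinant is zero.\<close>

lemma gram_form_plane:
  fixes x y z t :: "real ^ 2"
  shows "gram_form (\<lambda>a b. (dist a b)\<^sup>2) x y z t = 0"
proof -
  have dist_sq: "(dist a b)\<^sup>2 = (a $ 1 - b $ 1)\<^sup>2 + (a $ 2 - b $ 2)\<^sup>2" for a b :: "real ^ 2"
    by (simp add: dist_norm power2_norm_eq_inner inner_vec_def sum_2) (simp add: power2_eq_square)
  define u v w where "u = y - x" and "v = z - x" and "w = t - x"
  then have "y = x + u" and "z = x + v" and "t = x + w"
    by simp_all
  then show ?thesis
    unfolding gram_form_def dist_sq Let_def by (simp add: power2_eq_square algebra_simps)
qed

lemma gram_form_scale: "gram_form (\<lambda>a b. c * f a b) x y z t = c ^ 3 * gram_form f x y z t"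
  by (simp add: gram_form_def Let_def algebra_simps power2_eq_square power3_eq_cube)

lemma gram_form_cong_distinct:
  assumes "distinct [x, y, z, t]"
    and "\<And>a b. a \<in> {x, y, z, t} \<Longrightarrow> b \<in> {x, y, z, t} \<Longrightarrow> a \<noteq> b \<Longrightarrow> f a b = g a b"
  shows "gram_form f x y z t = gram_form g x y z t"
  using assms by (simp add: gram_form_def)

lemma poly_gram_form:
  "poly (gram_form f x y z t) r = gram_form (\<lambda>a b. poly (f a b) r) x y z t"
  by (simp add: gram_form_def Let_def)

lemma of_int_gram_form:
  "of_int (gram_form f x y z t) = gram_form (\<lambda>a b. of_int (f a b)) x y z t"
  by (simp add: gram_form_def Let_def)

text \<open>The factor \<open>4\<close> is the determinant belonging to a regular tetrahedron of edge \<open>1\<close>.\<close>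

lemma gram_form_const: "gram_form (\<lambda>a b. r) x y z t = 4 * r ^ 3"
  by (simp add: gram_form_def power2_eq_square power3_eq_cube)

lemma gram_form_const_mod:
  fixes f :: "'p \<Rightarrow> 'p \<Rightarrow> int"
  assumes "\<And>a b. [f a b = r] (mod m)"
  shows "[gram_form f x y z t = 4 * r ^ 3] (mod m)"
proof -
  have "[gram_form f x y z t = gram_form (\<lambda>a b. r) x y z t] (mod m)"
    unfolding gram_form_def Let_def
    by (intro cong_add cong_diff cong_mult cong_pow cong_refl assms)
  then show ?thesis
    by (simp add: gram_form_const)
qed

section \<open>Polynomials with integer coefficients\<close>

lemma coeffs_Ints_closed:
  fixes p q :: "'a::comm_ring_1 poly"
  assumes "range (coeff p) \<subseteq> \<int>" and "range (coeff q) \<subseteq> \<int>"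
  shows "range (coeff (p + q)) \<subseteq> \<int>" and "range (coeff (p - q)) \<subseteq> \<int>"
    and "range (coeff (p * q)) \<subseteq> \<int>"
  using assms by (auto simp: coeff_mult image_subset_iff intro!: Ints_sum Ints_mult)

lemma coeffs_Ints_gram_form:
  fixes f :: "'p \<Rightarrow> 'p \<Rightarrow> 'a::comm_ring_1 poly"
  assumes "\<And>a b. range (coeff (f a b)) \<subseteq> \<int>"
  shows "range (coeff (gram_form f x y z t)) \<subseteq> \<int>"
proof -
  have "range (coeff (numeral n :: 'a poly)) \<subseteq> \<int>" for n
    by (auto simp: numeral_poly coeff_pCons split: nat.splits)
  then show ?thesis
    unfolding gram_form_def Let_def power2_eq_square
    by (intro coeffs_Ints_closed assms)
qed

section \<open>Four points with distances in a shifted copy of the integers\<close>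

text \<open>
  Dividing by \<open>s\<close> turns the regular tetrahedron of edge \<open>s\<close> into the one of edge \<open>1\<close>, so the
  polynomial in \<open>1 / s\<close> obtained from the vanishing determinant has constant coefficient \<open>4\<close>;
  in this form its being nonzero can be read off at \<open>0\<close>.
\<close>

lemma shifted_distances_algebraic:
  fixes x y z t :: "real ^ 2" and k :: "real ^ 2 \<Rightarrow> real ^ 2 \<Rightarrow> int"
  assumes dist: "distinct [x, y, z, t]"
    and k: "\<And>a b. a \<in> {x, y, z, t} \<Longrightarrow> b \<in> {x, y, z, t} \<Longrightarrow> a \<noteq> b \<Longrightarrow> dist a b = of_int (k a b) + s"
  shows "algebraic s"
proof (cases "s = 0")
  case False
  define P :: "real poly" where "P = gram_form (\<lambda>a b. [:1, of_int (k a b):]\<^sup>2) x y z t"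
  have "0 = gram_form (\<lambda>a b. (dist a b)\<^sup>2) x y z t"
    by (simp add: gram_form_plane)
  also have "\<dots> = gram_form (\<lambda>a b. s\<^sup>2 * (1 + inverse s * of_int (k a b))\<^sup>2) x y z t"
    using False k
    by (intro gram_form_cong_distinct dist) (simp add: field_simps flip: power_mult_distrib)
  also have "\<dots> = (s\<^sup>2) ^ 3 * poly P (inverse s)"
    by (simp add: gram_form_scale P_def poly_gram_form)
  finally have root: "poly P (inverse s) = 0"
    using False by simp
  have "poly P 0 = 4"
    by (simp add: P_def poly_gram_form gram_form_const)
  then have nonzero: "P \<noteq> 0"
    by auto
  have "range (coeff P) \<subseteq> \<int>"
    unfolding P_def power2_eq_square
    by (intro coeffs_Ints_gram_form coeffs_Ints_closed) (auto simp: coeff_pCons split: nat.splits)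
  then have "algebraic (inverse s)"
    using nonzero root by (intro algebraicI[of P]) auto
  then show ?thesis
    using algebraic_inverse by fastforce
qed simp

text \<open>
  For \<open>s = p / q\<close> the determinant is read modulo \<open>q\<close>, which excludes every denominator but \<open>1\<close>,
  \<open>2\<close> and \<open>4\<close>; the even ones need the finer modulus \<open>8\<close>, since \<open>4\<close> divides the determinant of the
  regular tetrahedron.
\<close>

lemma shifted_distances_integer:
  fixes x y z t :: "real ^ 2" and k :: "real ^ 2 \<Rightarrow> real ^ 2 \<Rightarrow> int"
  assumes dist: "distinct [x, y, z, t]"
    and k: "\<And>a b. a \<in> {x, y, z, t} \<Longrightarrow> b \<in> {x, y, z, t} \<Longrightarrow> a \<noteq> b \<Longrightarrow> dist a b = of_int (k a b) + s"
    and "s \<in> \<rat>"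
  shows "s \<in> \<int>"
proof -
  obtain p q :: int where q: "q > 0" and coprime: "coprime p q" and s: "s = of_int p / of_int q"
    using \<open>s \<in> \<rat>\<close> by (auto elim: Rats_cases')
  define D where "D = gram_form (\<lambda>a b. (k a b * q + p)\<^sup>2) x y z t"
  have "0 = (of_int q ^ 2) ^ 3 * gram_form (\<lambda>a b. (dist a b)\<^sup>2) x y z t"
    by (simp add: gram_form_plane)
  also have "\<dots> = gram_form (\<lambda>a b. of_int q ^ 2 * (dist a b)\<^sup>2) x y z t"
    by (simp add: gram_form_scale)
  also have "\<dots> = gram_form (\<lambda>a b. of_int ((k a b * q + p)\<^sup>2)) x y z t"
    using q k
    by (intro gram_form_cong_distinct dist) (simp add: s field_simps flip: power_mult_distrib)
  also have "\<dots> = of_int D"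
    by (simp only: D_def of_int_gram_form)
  finally have D: "D = 0"
    by simp
  have "[(k a b * q + p)\<^sup>2 = p\<^sup>2] (mod q)" for a b
    by (intro cong_pow) (simp add: cong_def)
  then have "[D = 4 * (p\<^sup>2) ^ 3] (mod q)"
    unfolding D_def by (rule gram_form_const_mod)
  then have "q dvd 4 * (p\<^sup>2) ^ 3"
    by (simp add: D cong_0_iff cong_sym_eq[of 0])
  then have q4: "q dvd 4"
    using coprime by (simp add: coprime_dvd_mult_left_iff coprime_commute)
  have "odd q"
  proof
    assume "even q"
    then have "odd p"
      using coprime by (meson coprime_common_divisor odd_one)
    have "[(k a b * q + p)\<^sup>2 = 1] (mod 8)" for a b
    proof -
      from \<open>even q\<close> \<open>odd p\<close> obtain j where "k a b * q + p = 2 * j + 1"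
        by (meson oddE even_add even_mult_iff)
      then have "(k a b * q + p)\<^sup>2 - 1 = 4 * (j * (j + 1))"
        by (simp add: algebra_simps power2_eq_square)
      moreover have "4 * 2 dvd 4 * (j * (j + 1))"
        by (intro mult_dvd_mono) simp_all
      ultimately show ?thesis
        by (simp add: cong_iff_dvd_diff)
    qed
    then have "[D = 4 * 1 ^ 3] (mod 8)"
      unfolding D_def by (rule gram_form_const_mod)
    then show False
      by (simp add: D cong_def)
  qed
  then have "coprime q (2 ^ 2)"
    by (subst coprime_power_right_iff) simp
  with q4 have "q = 1"
    using q coprime_absorb_left by fastforce
  then show ?thesis
    by (simp add: s)
qed

section \<open>Distance sets in a shifted copy of the natural numbers\<close>

lemma obtain_four_distinct:
  assumes "\<not> (finite A \<and> card A \<le> 3)"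
  obtains x y z t where "{x, y, z, t} \<subseteq> A" and "distinct [x, y, z, t]"
proof -
  obtain B where "B \<subseteq> A" and "card B = 4"
  proof (cases "finite A")
    case True
    then show ?thesis
      using assms that obtain_subset_with_card_n[of 4 A] by auto
  next
    case False
    then show ?thesis
      using that infinite_arbitrarily_large by blast
  qed
  then obtain xs where "set xs = B" and "distinct xs" and "length xs = 4"
    by (metis card.infinite distinct_card finite_distinct_list zero_neq_numeral)
  then show ?thesis
    using that \<open>B \<subseteq> A\<close> by (auto simp: numeral_eq_Suc length_Suc_conv)
qed

theorem theorem1p2:
  fixes s :: real and A :: "(real ^ 2) set"
  assumes "\<not> algebraic s \<or> s \<in> \<rat> - {k / 2 | k. k \<in> \<int>}"
    and "distance_set A \<subseteq> {k + s | k. k \<in> \<nat>}"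
  shows "finite A \<and> card A \<le> 3"
proof (rule ccontr)
  assume "\<not> (finite A \<and> card A \<le> 3)"
  then obtain x y z t where sub: "{x, y, z, t} \<subseteq> A" and dist: "distinct [x, y, z, t]"
    by (rule obtain_four_distinct)
  have "\<exists>k::int. dist a b = of_int k + s" if "a \<in> A" "b \<in> A" "a \<noteq> b" for a b
  proof -
    have "dist a b \<in> distance_set A"
      using that by (auto simp: distance_set_def)
    then obtain n :: nat where "dist a b = of_nat n + s"
      using assms(2) by (auto elim: Nats_cases)
    then have "dist a b = of_int (int n) + s"
      by simp
    then show ?thesis ..
  qed
  then obtain k :: "real ^ 2 \<Rightarrow> real ^ 2 \<Rightarrow> int"
    where "\<And>a b. a \<in> A \<Longrightarrow> b \<in> A \<Longrightarrow> a \<noteq> b \<Longrightarrow> dist a b = of_int (k a b) + s"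
    by metis
  then have k: "dist a b = of_int (k a b) + s"
    if "a \<in> {x, y, z, t}" "b \<in> {x, y, z, t}" "a \<noteq> b" for a b
    using that sub by blast
  have "algebraic s"
    using dist k by (rule shifted_distances_algebraic)
  with assms(1) have "s \<in> \<rat>" and half: "s \<notin> {k / 2 | k. k \<in> \<int>}"
    by auto
  then have "s \<in> \<int>"
    using shifted_distances_integer[OF dist k] by blast
  then have "2 * s \<in> \<int>" and "s = 2 * s / 2"
    by auto
  with half show False
    by blast
qed

end
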